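(* If $A_m=(a_{ij})$ is an extreme point of $\mathbf{U}_m$, then $a_{ii}\in\{0,1\}$ for every $i\in I_m$ and $a_{ij}\in\{0,\tfrac12,1\}$ for all $i\neq j$ in $I_m$. In other words, $\mathrm{Extr}\,\mathbf{U}_m\subset\mathbf{U}_m^{(0,\frac12,1)}$.
   Context: $I_m=\{1,\dots,m\}$. $\mathbf{U}_m$ is the set of real $m\times m$ matrices $A_m=(a_{ij})$ with $a_{ij}=a_{ji}\ge 0$ for all $i,j$ and $\sum_{i,j\in\alpha}a_{ij}\le|\alpha|$ for every $\alpha\subset I_m$ ($|\alpha|$ the cardinality). $\mathbf{U}_m^{(0,\frac12,1)}=\{A_m\in\mathbf{U}_m:\ a_{ii}\in\{0,1\},\ a_{ij}\in\{0,\tfrac12,1\}\ \forall i,j\}$. $\mathrm{Extr}$ denotes the set of extreme points. *)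

theory Defs
  imports "HOL-Analysis.Analysis"
begin

text \<open>
  The index set \<open>I\<^sub>m\<close> is the universe of a finite type \<open>'m\<close>, with \<open>m = CARD('m) \<ge> 1\<close>
  arbitrary. Sums run over ordered pairs of indices, so each off-diagonal entry
  is counted twice.
\<close>

definition U_mat :: "(real ^ 'm ^ 'm) set" where
  "U_mat = {A. (\<forall>i j. A $ i $ j = A $ j $ i \<and> 0 \<le> A $ i $ j) \<and>
               (\<forall>\<alpha> :: 'm set. (\<Sum>i\<in>\<alpha>. \<Sum>j\<in>\<alpha>. A $ i $ j) \<le> real (card \<alpha>))}"

definition U_mat_half :: "(real ^ 'm ^ 'm) set" where
  "U_mat_half = {A \<in> U_mat. (\<forall>i. A $ i $ i \<in> {0, 1}) \<and> (\<forall>i j. A $ i $ j \<in> {0, 1/2, 1})}"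

definition Extr :: "'a::real_vector set \<Rightarrow> 'a set" where
  "Extr S = {x. x extreme_point_of S}"

end

theory Submission imports Defs begin

text \<open>
  Give the edge or loop \<open>{i, j}\<close> the total weight \<open>|{i, j}| a\<^sub>i\<^sub>j\<close> of its matrix entries. The
  constraint for \<open>\<alpha>\<close> then bounds the weight of the edges inside \<open>\<alpha>\<close>, and the claim says that the
  weights are integers. This holds for weights of arbitrary hyperedges and for any integral
  submodular bound in place of \<open>|\<alpha>|\<close>: the weight inside \<open>\<alpha>\<close> is supermodular in \<open>\<alpha>\<close>, so tight sets
  are closed under intersection. If no tight set contains a fractional edge \<open>e\<close>, the weight of \<open>e\<close>
  can be moved in both directions. Otherwise a minimal tight set containing a fractional edge \<open>e\<close>
  contains a second one, \<open>f\<close>, by integrality of the bound; by minimality a tight set contains both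
  \<open>e\<close> and \<open>f\<close> or neither, so weight can be shifted between them.
\<close>

lemma extreme_point_perturbation_eq_0:
  fixes x d :: "'a::real_vector"
  assumes "x extreme_point_of S" and "\<forall>\<^sub>F t::real in nhds 0. x + t *\<^sub>R d \<in> S"
  shows "d = 0"
proof (rule ccontr)
  assume "d \<noteq> 0"
  obtain \<epsilon> :: real where "\<epsilon> > 0" and in_S: "\<And>t. \<bar>t\<bar> < \<epsilon> \<Longrightarrow> x + t *\<^sub>R d \<in> S"
    using assms(2) by (auto simp: eventually_nhds_metric dist_real_def)
  let ?a = "x + (\<epsilon> / 2) *\<^sub>R d" and ?b = "x + (- (\<epsilon> / 2)) *\<^sub>R d"
  have "?a \<noteq> ?b" "midpoint ?a ?b = x"
    using \<open>d \<noteq> 0\<close> \<open>\<epsilon> > 0\<close> by (auto simp: midpoint_def algebra_simps simp flip: scaleR_2)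
  then have "x \<in> open_segment ?a ?b"
    using midpoint_in_open_segment by metis
  moreover have "?a \<in> S" "?b \<in> S"
    using \<open>\<epsilon> > 0\<close> by (auto intro!: in_S simp del: scaleR_minus_left)
  ultimately show False
    using assms(1) by (auto simp: extreme_point_of_def)
qed

lemma extreme_point_of_linear_preimage:
  assumes "linear f" and "f ` T \<subseteq> S" and "f x extreme_point_of S" and "x \<in> T"
    and separated: "\<And>a b. a \<in> T \<Longrightarrow> b \<in> T \<Longrightarrow> x \<in> open_segment a b \<Longrightarrow> f a \<noteq> f b"
  shows "x extreme_point_of T"
proof -
  have "x \<notin> open_segment a b" if "a \<in> T" "b \<in> T" for a b
  proof
    assume x: "x \<in> open_segment a b"
    then obtain t where "0 < t" "t < 1" and "x = (1 - t) *\<^sub>R a + t *\<^sub>R b"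
      by (auto simp: in_segment)
    then have "f x \<in> open_segment (f a) (f b)"
      using separated[OF that x] by (auto simp: in_segment linear_add linear_scale \<open>linear f\<close>)
    moreover have "f a \<in> S" "f b \<in> S"
      using that \<open>f ` T \<subseteq> S\<close> by auto
    ultimately show False
      using \<open>f x extreme_point_of S\<close> by (auto simp: extreme_point_of_def)
  qed
  with \<open>x \<in> T\<close> show ?thesis
    by (simp add: extreme_point_of_def)
qed

lemma eventually_nonneg_perturbation:
  fixes a b :: real
  assumes "0 \<le> a" and "a = 0 \<Longrightarrow> b = 0"
  shows "\<forall>\<^sub>F t in nhds 0. 0 \<le> a + t * b"
proof (cases "a = 0")
  case False
  have "((\<lambda>t. a + t * b) \<longlongrightarrow> a + 0 * b) (nhds 0)"
    by (intro tendsto_intros filterlim_ident)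
  then have "\<forall>\<^sub>F t in nhds 0. 0 < a + t * b"
    by (rule order_tendstoD) (use False assms in auto)
  then show ?thesis by (rule eventually_mono) simp
qed (use assms in simp)

section \<open>Hyperedge weights under a submodular bound\<close>

definition submodular :: "('a set \<Rightarrow> real) \<Rightarrow> bool" where
  "submodular r \<longleftrightarrow> (\<forall>\<alpha> \<beta>. r (\<alpha> \<union> \<beta>) + r (\<alpha> \<inter> \<beta>) \<le> r \<alpha> + r \<beta>)"

definition induced_weight :: "real ^ ('a::finite) set \<Rightarrow> 'a set \<Rightarrow> real" where
  "induced_weight w \<alpha> = (\<Sum>e\<in>Pow \<alpha>. w $ e)"

definition weight_polytope :: "('a set \<Rightarrow> real) \<Rightarrow> (real ^ ('a::finite) set) set" where
  "weight_polytope r = {w. (\<forall>e. 0 \<le> w $ e) \<and> (\<forall>\<alpha>. induced_weight w \<alpha> \<le> r \<alpha>)}"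

definition tight :: "('a set \<Rightarrow> real) \<Rightarrow> real ^ ('a::finite) set \<Rightarrow> 'a set \<Rightarrow> bool" where
  "tight r w \<alpha> \<longleftrightarrow> induced_weight w \<alpha> = r \<alpha>"

lemma submodular_card: "submodular (real \<circ> card :: 'a::finite set \<Rightarrow> real)"
proof -
  have "real (card (\<alpha> \<union> \<beta>)) + real (card (\<alpha> \<inter> \<beta>)) = real (card \<alpha>) + real (card \<beta>)"
    for \<alpha> \<beta> :: "'a set"
    using card_Un_Int[of \<alpha> \<beta>] by (simp flip: of_nat_add)
  then show ?thesis by (simp add: submodular_def)
qed

lemma linear_induced_weight: "linear (\<lambda>w. induced_weight w \<alpha>)"
  by (rule linearI) (simp_all add: induced_weight_def sum.distrib sum_distrib_left)

lemma induced_weight_axis: "induced_weight (axis e 1) \<alpha> = of_bool (e \<subseteq> \<alpha>)"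
  by (simp add: induced_weight_def axis_def)

lemma induced_weight_supermodular:
  fixes w :: "real ^ ('a::finite) set"
  assumes "\<And>e. 0 \<le> w $ e"
  shows "induced_weight w \<alpha> + induced_weight w \<beta>
    \<le> induced_weight w (\<alpha> \<union> \<beta>) + induced_weight w (\<alpha> \<inter> \<beta>)"
proof -
  have "induced_weight w \<alpha> + induced_weight w \<beta>
      = (\<Sum>e\<in>Pow \<alpha> \<union> Pow \<beta>. w $ e) + induced_weight w (\<alpha> \<inter> \<beta>)"
    by (simp add: induced_weight_def Pow_Int_eq sum.union_inter)
  also have "(\<Sum>e\<in>Pow \<alpha> \<union> Pow \<beta>. w $ e) \<le> induced_weight w (\<alpha> \<union> \<beta>)"
    unfolding induced_weight_def by (rule sum_mono2) (auto simp: assms)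
  finally show ?thesis by simp
qed

lemma weight_polytope_weight_le:
  fixes w :: "real ^ ('a::finite) set"
  assumes "w \<in> weight_polytope r"
  shows "w $ e \<le> r e"
proof -
  have "w $ e \<le> induced_weight w e"
    unfolding induced_weight_def
    using assms by (intro member_le_sum) (auto simp: weight_polytope_def)
  also have "\<dots> \<le> r e"
    using assms by (simp add: weight_polytope_def)
  finally show ?thesis .
qed

lemma tight_Int:
  fixes w :: "real ^ ('a::finite) set"
  assumes "submodular r" and "w \<in> weight_polytope r" and "tight r w \<alpha>" and "tight r w \<beta>"
  shows "tight r w (\<alpha> \<inter> \<beta>)"
proof -
  have "induced_weight w (\<alpha> \<union> \<beta>) \<le> r (\<alpha> \<union> \<beta>)" "induced_weight w (\<alpha> \<inter> \<beta>) \<le> r (\<alpha> \<inter> \<beta>)"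
    and "induced_weight w \<alpha> + induced_weight w \<beta>
      \<le> induced_weight w (\<alpha> \<union> \<beta>) + induced_weight w (\<alpha> \<inter> \<beta>)"
    using assms(2) by (auto simp: weight_polytope_def intro: induced_weight_supermodular)
  moreover have "r (\<alpha> \<union> \<beta>) + r (\<alpha> \<inter> \<beta>) \<le> r \<alpha> + r \<beta>"
    using assms(1) by (simp add: submodular_def)
  ultimately show ?thesis
    using assms(3,4) by (simp add: tight_def)
qed

lemma second_fractional_edge:
  fixes w :: "real ^ ('a::finite) set"
  assumes "induced_weight w \<alpha> \<in> \<int>" and "e \<subseteq> \<alpha>" and "w $ e \<notin> \<int>"
  obtains f where "f \<subseteq> \<alpha>" "f \<noteq> e" "w $ f \<notin> \<int>"
proof (rule ccontr)
  assume "\<not> thesis"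
  then have "(\<Sum>f\<in>Pow \<alpha> - {e}. w $ f) \<in> \<int>"
    using that by (intro Ints_sum) blast
  moreover have "w $ e = induced_weight w \<alpha> - (\<Sum>f\<in>Pow \<alpha> - {e}. w $ f)"
    using assms(2) by (simp add: induced_weight_def sum.remove[of "Pow \<alpha>" e])
  ultimately show False
    using assms(1,3) by (metis Ints_diff)
qed

lemma minimal_tight_set:
  fixes w :: "real ^ ('a::finite) set"
  assumes "submodular r" and "w \<in> weight_polytope r"
    and "tight r w \<beta>" and "e \<subseteq> \<beta>" and "P e"
  obtains \<alpha> f where "tight r w \<alpha>" "f \<subseteq> \<alpha>" "P f"
    "\<And>\<gamma> g. tight r w \<gamma> \<Longrightarrow> g \<subseteq> \<alpha> \<Longrightarrow> P g \<Longrightarrow> g \<subseteq> \<gamma> \<Longrightarrow> \<alpha> \<subseteq> \<gamma>"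
proof -
  let ?T = "{\<gamma>. tight r w \<gamma> \<and> (\<exists>g\<subseteq>\<gamma>. P g)}"
  have "?T \<noteq> {}"
    using assms(3-5) by auto
  then obtain \<alpha> where "\<alpha> \<in> ?T" and minimal: "\<And>\<gamma>. \<gamma> \<in> ?T \<Longrightarrow> \<gamma> \<subseteq> \<alpha> \<Longrightarrow> \<alpha> = \<gamma>"
    using finite_has_minimal[of ?T] by auto
  then obtain f where "tight r w \<alpha>" "f \<subseteq> \<alpha>" "P f"
    by auto
  moreover have "\<alpha> \<subseteq> \<gamma>" if "tight r w \<gamma>" "g \<subseteq> \<alpha>" "P g" "g \<subseteq> \<gamma>" for \<gamma> g
  proof -
    have "\<alpha> \<inter> \<gamma> \<in> ?T"
      using that \<open>tight r w \<alpha>\<close> tight_Int[OF assms(1,2)] by auto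
    with minimal[of "\<alpha> \<inter> \<gamma>"] show ?thesis by blast
  qed
  ultimately show thesis
    using that by blast
qed

lemma inseparable_fractional_edges:
  fixes w :: "real ^ ('a::finite) set"
  assumes "submodular r" and "\<And>\<alpha>. r \<alpha> \<in> \<int>" and "w \<in> weight_polytope r"
    and "tight r w \<beta>" and "e \<subseteq> \<beta>" and "w $ e \<notin> \<int>"
  obtains f g where "f \<noteq> g" "w $ f \<notin> \<int>" "w $ g \<notin> \<int>"
    "\<And>\<gamma>. tight r w \<gamma> \<Longrightarrow> f \<subseteq> \<gamma> \<longleftrightarrow> g \<subseteq> \<gamma>"
proof -
  obtain \<alpha> f where "tight r w \<alpha>" and f: "f \<subseteq> \<alpha>" "w $ f \<notin> \<int>"
    and minimal: "\<And>\<gamma> h. tight r w \<gamma> \<Longrightarrow> h \<subseteq> \<alpha> \<Longrightarrow> w $ h \<notin> \<int> \<Longrightarrow> h \<subseteq> \<gamma> \<Longrightarrow> \<alpha> \<subseteq> \<gamma>"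
    using minimal_tight_set[OF assms(1,3-5), where P = "\<lambda>e. w $ e \<notin> \<int>"] assms(6) by metis
  have "induced_weight w \<alpha> \<in> \<int>"
    using \<open>tight r w \<alpha>\<close> assms(2) by (simp add: tight_def)
  then obtain g where g: "g \<subseteq> \<alpha>" "w $ g \<notin> \<int>" and "g \<noteq> f"
    using second_fractional_edge f by metis
  moreover have "f \<subseteq> \<gamma> \<longleftrightarrow> g \<subseteq> \<gamma>" if "tight r w \<gamma>" for \<gamma>
    using minimal[OF that] f g by blast
  ultimately show thesis
    using that f(2) by metis
qed

lemma tight_preserving_direction:
  fixes w :: "real ^ ('a::finite) set"
  assumes "submodular r" and "\<And>\<alpha>. r \<alpha> \<in> \<int>" and "w \<in> weight_polytope r" and "w $ e \<notin> \<int>"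
  obtains d where "d \<noteq> 0" "\<And>f. w $ f = 0 \<Longrightarrow> d $ f = 0"
    "\<And>\<alpha>. tight r w \<alpha> \<Longrightarrow> induced_weight d \<alpha> = 0"
proof (cases "\<exists>\<beta> f. tight r w \<beta> \<and> f \<subseteq> \<beta> \<and> w $ f \<notin> \<int>")
  case False
  show thesis
  proof (rule that)
    show "axis e (1::real) \<noteq> 0"
      by (simp add: axis_eq_0_iff)
    show "axis e 1 $ f = 0" if "w $ f = 0" for f
      using that assms(4) by (auto simp: axis_def)
    show "induced_weight (axis e 1) \<alpha> = 0" if "tight r w \<alpha>" for \<alpha>
      using that False assms(4) by (auto simp: induced_weight_axis)
  qed
next
  case True
  then obtain f g where "f \<noteq> g" "w $ f \<notin> \<int>" "w $ g \<notin> \<int>"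
    and inseparable: "\<And>\<gamma>. tight r w \<gamma> \<Longrightarrow> f \<subseteq> \<gamma> \<longleftrightarrow> g \<subseteq> \<gamma>"
    using inseparable_fractional_edges[OF assms(1-3)] by metis
  let ?d = "axis f 1 - axis g (1::real)"
  show thesis
  proof (rule that)
    show "?d \<noteq> 0"
      using \<open>f \<noteq> g\<close> by (simp add: axis_eq_axis)
    show "?d $ h = 0" if "w $ h = 0" for h
      using that \<open>w $ f \<notin> \<int>\<close> \<open>w $ g \<notin> \<int>\<close> by (auto simp: axis_def)
    show "induced_weight ?d \<gamma> = 0" if "tight r w \<gamma>" for \<gamma>
      using inseparable[OF that]
      by (simp add: linear_diff[OF linear_induced_weight] induced_weight_axis)
  qed
qed

lemma eventually_perturbation_in_weight_polytope:
  fixes w d :: "real ^ ('a::finite) set"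
  assumes w: "w \<in> weight_polytope r"
    and support: "\<And>e. w $ e = 0 \<Longrightarrow> d $ e = 0"
    and tight: "\<And>\<alpha>. tight r w \<alpha> \<Longrightarrow> induced_weight d \<alpha> = 0"
  shows "\<forall>\<^sub>F t in nhds 0. w + t *\<^sub>R d \<in> weight_polytope r"
proof -
  have "\<forall>\<^sub>F t in nhds 0. \<forall>e. 0 \<le> w $ e + t * d $ e"
    using w support
    by (intro eventually_all_finite eventually_nonneg_perturbation) (auto simp: weight_polytope_def)
  moreover have "\<forall>\<^sub>F t in nhds 0. \<forall>\<alpha>. 0 \<le> (r \<alpha> - induced_weight w \<alpha>) + t * (- induced_weight d \<alpha>)"
    using w tight
    by (intro eventually_all_finite eventually_nonneg_perturbation)
      (auto simp: weight_polytope_def tight_def)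
  ultimately show ?thesis
    by eventually_elim
      (simp add: weight_polytope_def linear_add[OF linear_induced_weight]
        linear_scale[OF linear_induced_weight] algebra_simps)
qed

theorem extreme_point_weight_polytope_Ints:
  fixes w :: "real ^ ('a::finite) set"
  assumes "submodular r" and "\<And>\<alpha>. r \<alpha> \<in> \<int>" and extreme: "w extreme_point_of weight_polytope r"
  shows "w $ e \<in> \<int>"
proof (rule ccontr)
  assume "w $ e \<notin> \<int>"
  have w: "w \<in> weight_polytope r"
    using extreme by (simp add: extreme_point_of_def)
  obtain d where "d \<noteq> 0" "\<And>f. w $ f = 0 \<Longrightarrow> d $ f = 0"
    "\<And>\<alpha>. tight r w \<alpha> \<Longrightarrow> induced_weight d \<alpha> = 0"
    using tight_preserving_direction[OF assms(1,2) w \<open>w $ e \<notin> \<int>\<close>] by metis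
  then show False
    using extreme_point_perturbation_eq_0[OF extreme]
      eventually_perturbation_in_weight_polytope[OF w] by blast
qed

section \<open>Symmetric matrices as edge weights\<close>

definition edge_weight :: "real ^ 'm ^ 'm \<Rightarrow> real ^ ('m::finite) set" where
  "edge_weight A = (\<chi> e. \<Sum>(i, j) | {i, j} = e. A $ i $ j)"

definition weight_matrix :: "real ^ ('m::finite) set \<Rightarrow> real ^ 'm ^ 'm" where
  "weight_matrix w = (\<chi> i j. w $ {i, j} / real (card {i, j}))"

lemma linear_weight_matrix: "linear weight_matrix"
  by (rule linearI) (simp_all add: weight_matrix_def vec_eq_iff add_divide_distrib)

lemma induced_weight_edge_weight:
  fixes A :: "real ^ 'm ^ 'm"
  shows "induced_weight (edge_weight A) \<alpha> = (\<Sum>i\<in>\<alpha>. \<Sum>j\<in>\<alpha>. A $ i $ j)"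
proof -
  have "induced_weight (edge_weight A) \<alpha>
      = (\<Sum>e\<in>Pow \<alpha>. \<Sum>(i, j) | (i, j) \<in> \<alpha> \<times> \<alpha> \<and> {i, j} = e. A $ i $ j)"
    unfolding induced_weight_def edge_weight_def by (auto intro!: sum.cong)
  also have "\<dots> = (\<Sum>(i, j)\<in>\<alpha> \<times> \<alpha>. A $ i $ j)"
    by (subst sum.group[symmetric, of "\<alpha> \<times> \<alpha>" "Pow \<alpha>" "\<lambda>(i, j). {i, j}"])
      (auto simp: case_prod_unfold mem_Times_iff)
  finally show ?thesis
    by (simp add: sum.cartesian_product)
qed

lemma edge_weight_doubleton:
  assumes "A $ i $ j = A $ j $ i"
  shows "edge_weight A $ {i, j} = real (card {i, j}) * A $ i $ j"
proof -
  have "{(k, l). {k, l} = {i, j}} = {(i, j), (j, i)}"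
    by (auto simp: doubleton_eq_iff)
  then show ?thesis
    using assms by (cases "i = j") (auto simp: edge_weight_def)
qed

lemma edge_weight_not_doubleton: "(\<And>i j. e \<noteq> {i, j}) \<Longrightarrow> edge_weight A $ e = 0"
  by (auto simp: edge_weight_def intro!: sum.neutral)

lemma weight_matrix_edge_weight:
  assumes "\<And>i j. A $ i $ j = A $ j $ i"
  shows "weight_matrix (edge_weight A) = A"
  by (simp add: vec_eq_iff weight_matrix_def edge_weight_doubleton[OF assms])

lemma edge_weight_weight_matrix_le:
  assumes "0 \<le> w $ e"
  shows "edge_weight (weight_matrix w) $ e \<le> w $ e"
proof (cases "\<exists>i j. e = {i, j}")
  case True
  then obtain i j where "e = {i, j}" by blast
  then show ?thesis
    by (simp add: edge_weight_doubleton weight_matrix_def insert_commute)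
next
  case False
  with assms show ?thesis
    by (simp add: edge_weight_not_doubleton)
qed

lemma U_mat_iff:
  "A \<in> U_mat \<longleftrightarrow> (\<forall>i j. A $ i $ j = A $ j $ i) \<and> (\<forall>i j. 0 \<le> A $ i $ j) \<and>
     (\<forall>\<alpha>. induced_weight (edge_weight A) \<alpha> \<le> real (card \<alpha>))"
  unfolding U_mat_def induced_weight_edge_weight by blast

lemma edge_weight_in_weight_polytope:
  "A \<in> U_mat \<Longrightarrow> edge_weight A \<in> weight_polytope (real \<circ> card)"
  by (auto simp: weight_polytope_def U_mat_iff edge_weight_def intro!: sum_nonneg)

lemma weight_matrix_in_U_mat:
  fixes w :: "real ^ ('m::finite) set"
  assumes "w \<in> weight_polytope (real \<circ> card)"
  shows "weight_matrix w \<in> U_mat"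
proof -
  have "induced_weight (edge_weight (weight_matrix w)) \<alpha> \<le> induced_weight w \<alpha>" for \<alpha>
    using assms unfolding induced_weight_def
    by (intro sum_mono edge_weight_weight_matrix_le) (simp add: weight_polytope_def)
  also have "induced_weight w \<alpha> \<le> real (card \<alpha>)" for \<alpha>
    using assms by (simp add: weight_polytope_def)
  finally show ?thesis
    using assms by (simp add: U_mat_iff weight_matrix_def weight_polytope_def insert_commute)
qed

lemma weight_matrix_separates_around_edge_weight:
  fixes A :: "real ^ 'm ^ 'm"
  assumes "edge_weight A \<in> open_segment u v" and nonneg: "\<And>e. 0 \<le> u $ e" "\<And>e. 0 \<le> v $ e"
  shows "weight_matrix u \<noteq> weight_matrix v"
proof
  assume matrix_eq: "weight_matrix u = weight_matrix v"
  obtain t where "u \<noteq> v" "0 < t" "t < 1" and segment: "edge_weight A = (1 - t) *\<^sub>R u + t *\<^sub>R v"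
    using assms(1) by (auto simp: in_segment)
  have "u $ e = v $ e" for e
  proof (cases "\<exists>i j. e = {i, j}")
    case True
    then obtain i j where "e = {i, j}" by blast
    moreover have "weight_matrix u $ i $ j = weight_matrix v $ i $ j"
      by (simp add: matrix_eq)
    ultimately show ?thesis
      by (simp add: weight_matrix_def)
  next
    case False
    then have "(1 - t) * u $ e + t * v $ e = 0"
      using edge_weight_not_doubleton[of e A] by (simp add: segment)
    then show ?thesis
      using nonneg[of e] \<open>0 < t\<close> \<open>t < 1\<close> by (simp add: add_nonneg_eq_0_iff)
  qed
  with \<open>u \<noteq> v\<close> show False by (simp add: vec_eq_iff)
qed

lemma extreme_point_edge_weight:
  fixes A :: "real ^ 'm ^ 'm"
  assumes "A extreme_point_of U_mat"
  shows "edge_weight A extreme_point_of weight_polytope (real \<circ> card)"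
proof (rule extreme_point_of_linear_preimage[OF linear_weight_matrix])
  have A: "A \<in> U_mat"
    using assms by (simp add: extreme_point_of_def)
  then show "weight_matrix (edge_weight A) extreme_point_of U_mat"
    using assms by (simp add: weight_matrix_edge_weight U_mat_iff)
  show "edge_weight A \<in> weight_polytope (real \<circ> card)"
    using A by (rule edge_weight_in_weight_polytope)
  show "weight_matrix ` weight_polytope (real \<circ> card) \<subseteq> U_mat"
    using weight_matrix_in_U_mat by blast
  show "weight_matrix u \<noteq> weight_matrix v"
    if "u \<in> weight_polytope (real \<circ> card)" "v \<in> weight_polytope (real \<circ> card)"
      and "edge_weight A \<in> open_segment u v" for u v
    using that
    by (intro weight_matrix_separates_around_edge_weight) (simp_all add: weight_polytope_def)
qed

lemma extreme_point_U_mat_entry: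
  fixes A :: "real ^ 'm ^ 'm"
  assumes "A extreme_point_of U_mat"
  shows "\<exists>k \<le> card {i, j}. A $ i $ j = real k / real (card {i, j})"
proof -
  have A: "A \<in> U_mat"
    using assms by (simp add: extreme_point_of_def)
  have "edge_weight A $ {i, j} \<in> \<int>"
    by (rule extreme_point_weight_polytope_Ints[OF submodular_card])
      (simp_all add: extreme_point_edge_weight[OF assms])
  moreover have "0 \<le> edge_weight A $ {i, j}"
    using edge_weight_in_weight_polytope[OF A] by (simp add: weight_polytope_def)
  ultimately obtain k where k: "edge_weight A $ {i, j} = real k"
    by (metis Ints_cases of_int_0_le_iff of_int_of_nat_eq zero_le_imp_eq_int)
  have "edge_weight A $ {i, j} = real (card {i, j}) * A $ i $ j"
    using A by (intro edge_weight_doubleton) (simp add: U_mat_iff)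
  then have "A $ i $ j = real k / real (card {i, j})"
    using k by (simp add: field_simps)
  moreover have "k \<le> card {i, j}"
    using weight_polytope_weight_le[OF edge_weight_in_weight_polytope[OF A], of "{i, j}"] k
    by simp
  ultimately show ?thesis by blast
qed

lemma extreme_point_U_mat_diagonal:
  assumes "A extreme_point_of U_mat"
  shows "A $ i $ i \<in> {0, 1}"
proof -
  obtain k where "k \<le> 1" "A $ i $ i = real k"
    using extreme_point_U_mat_entry[OF assms, of i i] by auto
  then show ?thesis by (auto simp: le_Suc_eq)
qed

lemma extreme_point_U_mat_half_integral:
  assumes "A extreme_point_of U_mat"
  shows "A $ i $ j \<in> {0, 1/2, 1}"
proof (cases "i = j")
  case True
  with extreme_point_U_mat_diagonal[OF assms, of i] show ?thesis by auto
next
  case False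
  then obtain k where "k \<le> 2" "A $ i $ j = real k / 2"
    using extreme_point_U_mat_entry[OF assms, of i j] by auto
  then show ?thesis by (auto simp: le_Suc_eq numeral_2_eq_2)
qed

theorem theorem3p2:
  shows "(\<forall>A :: real ^ 'm ^ 'm. A \<in> Extr U_mat \<longrightarrow>
            (\<forall>i. A $ i $ i \<in> {0, 1}) \<and>
            (\<forall>i j. i \<noteq> j \<longrightarrow> A $ i $ j \<in> {0, 1/2, 1}))
         \<and> Extr (U_mat :: (real ^ 'm ^ 'm) set) \<subseteq> U_mat_half"
proof (intro conjI allI impI subsetI)
  fix A :: "real ^ 'm ^ 'm" and i j
  assume "A \<in> Extr U_mat"
  then have extreme: "A extreme_point_of U_mat"
    by (simp add: Extr_def)
  show "A $ i $ i \<in> {0, 1}"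
    by (rule extreme_point_U_mat_diagonal[OF extreme])
  show "A $ i $ j \<in> {0, 1/2, 1}"
    by (rule extreme_point_U_mat_half_integral[OF extreme])
  have "A \<in> U_mat"
    using extreme by (simp add: extreme_point_of_def)
  then show "A \<in> U_mat_half"
    using extreme_point_U_mat_diagonal[OF extreme] extreme_point_U_mat_half_integral[OF extreme]
    by (simp add: U_mat_half_def)
qed

end
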